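(* Let $G$ be a (not necessarily commutative) finite group of order $v$, written additively, and let $A\in\mathcal{C}^3_3(v,k,\lambda)$. Then $A$ can be constructed from a $(v,k,\lambda)$ difference set of propriety $3$ in $G$ (that is, $A$ is isotopic to the cube with support $\operatorname{dev}D$ for some $(v,k,\lambda)$ difference set $D\subseteq G^2$ of propriety $3$) if and only if $\operatorname{Atop}(A)$ has a subgroup isomorphic to $G$ acting sharply transitively on each of the three coordinates.
   Context: Cubes are functions $A:X^3\to\{0,1\}$, with $X$ an index set of size $v$ (such as $\{1,\dots,v\}$ or $G$); the support of $A$ is $\{(x,y,z)\mid A(x,y,z)=1\}$. A layer is obtained by fixing one of the three coordinates; two layers are parallel if they fix the same coordinate, to different values; their scalar product is the sum over all positions of the product of corresponding entries. $\mathcal{C}^3_3(v,k,\lambda)$ is the set of cubes such that every layer (in each of the three directions) contains exactly $k$ ones and every two parallel layers have scalar product $\lambda$. Two cubes $A:X^3\to\{0,1\}$ and $B:Y^3\to\{0,1\}$ are isotopic if there are bijections $\alpha,\beta,\gamma:X\to Y$ with $B(\alpha(x),\beta(y),\gamma(z))=A(x,y,z)$ for all $x,y,z$. The full autotopy group $\operatorname{Atop}(A)$ is the group of all triples $(\alpha,\beta,\gamma)$ of permutations of $X$ with $A(\alpha(x),\beta(y),\gamma(z))=A(x,y,z)$ for all $x,y,z\in X$, under coordinatewise composition. It acts on the first, second and third coordinate set $X$ via $\alpha$, $\beta$ and $\gamma$, respectively. An action is sharply transitive if for all $x,x'\in X$ exactly one group element maps $x$ to $x'$. A set $D\subseteq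 G^2$ with $|D|=k$ is a $(v,k,\lambda)$ difference set of propriety $3$ if for every $g\in G\setminus\{0\}$: 1. there are exactly $\lambda$ choices of $(x,y),(x',y')\in D$ with $-x+x'=-y+y'=g$; 2. there are exactly $\lambda$ choices of $(x,y),(x',y')\in D$ with $x-x'=g$ and $y=y'$; 3. there are exactly $\lambda$ choices of $(x,y),(x',y')\in D$ with $x=x'$ and $y-y'=g$. Its development is $\operatorname{dev}D=\{(x+g,y+g,g)\mid (x,y)\in D,\ g\in G\}\subseteq G^3$. *)

theory Defs
  imports "HOL-Algebra.Coset" "HOL-Algebra.Bij" "HOL-Library.Indicator_Function"
begin

text \<open>
  The index set \<open>X\<close> is an explicit carrier, so a cube is relevant only through its
  values on \<open>X \<times> X \<times> X\<close>; every notion below looks at these values only.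
\<close>

definition layer1 :: "('x \<times> 'x \<times> 'x \<Rightarrow> nat) \<Rightarrow> 'x \<Rightarrow> 'x \<times> 'x \<Rightarrow> nat" where
  "layer1 A a = (\<lambda>(y, z). A (a, y, z))"

definition layer2 :: "('x \<times> 'x \<times> 'x \<Rightarrow> nat) \<Rightarrow> 'x \<Rightarrow> 'x \<times> 'x \<Rightarrow> nat" where
  "layer2 A a = (\<lambda>(x, z). A (x, a, z))"

definition layer3 :: "('x \<times> 'x \<times> 'x \<Rightarrow> nat) \<Rightarrow> 'x \<Rightarrow> 'x \<times> 'x \<Rightarrow> nat" where
  "layer3 A a = (\<lambda>(x, y). A (x, y, a))"

definition num_ones :: "'x set \<Rightarrow> ('x \<times> 'x \<Rightarrow> nat) \<Rightarrow> nat" where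
  "num_ones X L = card {p \<in> X \<times> X. L p = 1}"

definition scalar_product :: "'x set \<Rightarrow> ('x \<times> 'x \<Rightarrow> nat) \<Rightarrow> ('x \<times> 'x \<Rightarrow> nat) \<Rightarrow> nat" where
  "scalar_product X L M = (\<Sum>p\<in>X \<times> X. L p * M p)"

definition cubes :: "'x set \<Rightarrow> nat \<Rightarrow> nat \<Rightarrow> nat \<Rightarrow> ('x \<times> 'x \<times> 'x \<Rightarrow> nat) set" where
  "cubes X v k l =
    {A \<in> X \<times> X \<times> X \<rightarrow> {0, 1}.
      finite X \<and> card X = v \<and>
      (\<forall>layer \<in> {layer1, layer2, layer3}.
        (\<forall>a\<in>X. num_ones X (layer A a) = k) \<and>
        (\<forall>a\<in>X. \<forall>b\<in>X. a \<noteq> b \<longrightarrow> scalar_product X (layer A a) (layer A b) = l))}"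

definition isotopic ::
  "'x set \<Rightarrow> ('x \<times> 'x \<times> 'x \<Rightarrow> nat) \<Rightarrow> 'y set \<Rightarrow> ('y \<times> 'y \<times> 'y \<Rightarrow> nat) \<Rightarrow> bool" where
  "isotopic X A Y B \<longleftrightarrow>
    (\<exists>\<alpha> \<beta> \<gamma>. bij_betw \<alpha> X Y \<and> bij_betw \<beta> X Y \<and> bij_betw \<gamma> X Y \<and>
      (\<forall>x\<in>X. \<forall>y\<in>X. \<forall>z\<in>X. B (\<alpha> x, \<beta> y, \<gamma> z) = A (x, y, z)))"

definition Atop ::
  "'x set \<Rightarrow> ('x \<times> 'x \<times> 'x \<Rightarrow> nat) \<Rightarrow> (('x \<Rightarrow> 'x) \<times> ('x \<Rightarrow> 'x) \<times> ('x \<Rightarrow> 'x)) monoid" where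
  "Atop X A = (BijGroup X \<times>\<times> BijGroup X \<times>\<times> BijGroup X)
    \<lparr>carrier := {(\<alpha>, \<beta>, \<gamma>) \<in> Bij X \<times> Bij X \<times> Bij X.
      \<forall>x\<in>X. \<forall>y\<in>X. \<forall>z\<in>X. A (\<alpha> x, \<beta> y, \<gamma> z) = A (x, y, z)}\<rparr>"

text \<open>\<open>act h\<close> is the permutation of \<open>X\<close> by which \<open>h\<close> acts.\<close>

definition sharply_transitive :: "'x set \<Rightarrow> 'h set \<Rightarrow> ('h \<Rightarrow> 'x \<Rightarrow> 'x) \<Rightarrow> bool" where
  "sharply_transitive X H act \<longleftrightarrow> (\<forall>x\<in>X. \<forall>x'\<in>X. \<exists>!h. h \<in> H \<and> act h x = x')"

text \<open>
  Groups are written multiplicatively, as in HOL-Algebra: \<open>x + g\<close> is \<open>x \<otimes> g\<close>,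
  \<open>-x + x'\<close> is \<open>inv x \<otimes> x'\<close> and \<open>x - x'\<close> is \<open>x \<otimes> inv x'\<close>.
  The order of the factors matters, since the group need not be commutative.
\<close>

definition difference_set3 ::
  "('g, 'm) monoid_scheme \<Rightarrow> nat \<Rightarrow> nat \<Rightarrow> nat \<Rightarrow> ('g \<times> 'g) set \<Rightarrow> bool" where
  "difference_set3 G v k l D \<longleftrightarrow>
    finite (carrier G) \<and> order G = v \<and> D \<subseteq> carrier G \<times> carrier G \<and> card D = k \<and>
    (\<forall>g \<in> carrier G - {\<one>\<^bsub>G\<^esub>}.
      card {((x, y), (x', y')) \<in> D \<times> D.
        inv\<^bsub>G\<^esub> x \<otimes>\<^bsub>G\<^esub> x' = g \<and> inv\<^bsub>G\<^esub> y \<otimes>\<^bsub>G\<^esub> y' = g} = l \<and>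
      card {((x, y), (x', y')) \<in> D \<times> D. x \<otimes>\<^bsub>G\<^esub> inv\<^bsub>G\<^esub> x' = g \<and> y = y'} = l \<and>
      card {((x, y), (x', y')) \<in> D \<times> D. x = x' \<and> y \<otimes>\<^bsub>G\<^esub> inv\<^bsub>G\<^esub> y' = g} = l)"

definition dev :: "('g, 'm) monoid_scheme \<Rightarrow> ('g \<times> 'g) set \<Rightarrow> ('g \<times> 'g \<times> 'g) set" where
  "dev G D = {(x \<otimes>\<^bsub>G\<^esub> g, y \<otimes>\<^bsub>G\<^esub> g, g) | x y g. (x, y) \<in> D \<and> g \<in> carrier G}"

end

theory Submission imports Defs begin

text \<open>
  Right translations \<open>(a, b, c) \<mapsto> (a + g, b + g, c + g)\<close> preserve \<open>dev D\<close> and form a copy of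
  \<open>G\<close> that is sharply transitive on each coordinate; an isotopy transports it to \<open>A\<close>.
  Conversely, if \<open>H\<close> is sharply transitive, each coordinate set can be identified
  with \<open>G\<close> through the orbit of a base point so that \<open>H\<close> acts by right translations. The
  cube then is the development of its layer at the neutral element, and counting ones in
  layers and in intersections of layers gives the difference set equations.
\<close>

section \<open>Membership in the development and its right translations\<close>

text \<open>The third coordinate of a point of \<open>dev G D\<close> is the translating element
  itself, so cancelling it on the right recovers the pair in \<open>D\<close>.\<close>

lemma (in group) mem_dev_iff:
  assumes "D \<subseteq> carrier G \<times> carrier G" "a \<in> carrier G" "b \<in> carrier G" "c \<in> carrier G"
  shows "(a, b, c) \<in> dev G D \<longleftrightarrow> (a \<otimes> inv c, b \<otimes> inv c) \<in> D"
proof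
  assume "(a, b, c) \<in> dev G D"
  then obtain x y where "(x, y) \<in> D" "a = x \<otimes> c" "b = y \<otimes> c"
    unfolding dev_def by auto
  moreover have "x \<in> carrier G" "y \<in> carrier G"
    using \<open>(x, y) \<in> D\<close> assms(1) by auto
  ultimately show "(a \<otimes> inv c, b \<otimes> inv c) \<in> D"
    using assms(4) by (simp add: m_assoc)
next
  assume "(a \<otimes> inv c, b \<otimes> inv c) \<in> D"
  moreover have "a = (a \<otimes> inv c) \<otimes> c" "b = (b \<otimes> inv c) \<otimes> c"
    using assms by (simp_all add: m_assoc)
  ultimately show "(a, b, c) \<in> dev G D"
    unfolding dev_def using assms(4) by blast
qed

text \<open>Membership depends only on the right quotients by the third coordinate, and a common
  right factor \<open>g\<close> cancels in them. This symmetry of the development is the source of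
  the autotopies.\<close>

lemma (in group) dev_right_translate_iff:
  assumes "D \<subseteq> carrier G \<times> carrier G"
    and "a \<in> carrier G" "b \<in> carrier G" "c \<in> carrier G" "g \<in> carrier G"
  shows "(a \<otimes> g, b \<otimes> g, c \<otimes> g) \<in> dev G D \<longleftrightarrow> (a, b, c) \<in> dev G D"
proof -
  have "(x \<otimes> g) \<otimes> inv (c \<otimes> g) = x \<otimes> inv c" if "x \<in> carrier G" for x
  proof -
    have "(x \<otimes> g) \<otimes> inv (c \<otimes> g) = x \<otimes> (g \<otimes> inv g) \<otimes> inv c"
      using that assms by (simp only: inv_mult_group m_assoc m_closed inv_closed)
    then show ?thesis
      using that assms by simp
  qed
  then show ?thesis
    using assms by (simp add: mem_dev_iff)
qed

section \<open>Counting in layers and invariance under isotopy\<close>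

text \<open>A product of 0/1 entries is 1 exactly where both factors are. Scalar products of layers
  thus become sizes of sets of positions, which can be matched bijectively with sets of pairs from
  \<open>D\<close>.\<close>

lemma scalar_product_eq_card:
  assumes "finite X" "L \<in> X \<times> X \<rightarrow> {0, 1}" "M \<in> X \<times> X \<rightarrow> {0, 1}"
  shows "scalar_product X L M = card {p \<in> X \<times> X. L p = 1 \<and> M p = 1}"
proof -
  have "scalar_product X L M = (\<Sum>p\<in>X \<times> X. if L p = 1 \<and> M p = 1 then 1 else 0)"
    unfolding scalar_product_def
  proof (rule sum.cong[OF refl])
    fix p assume "p \<in> X \<times> X"
    then have "L p \<in> {0, 1}" "M p \<in> {0, 1}"
      using assms(2,3) by (auto simp only: Pi_iff)
    then show "L p * M p = (if L p = 1 \<and> M p = 1 then 1 else 0)"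
      by auto
  qed
  also have "\<dots> = card {p \<in> X \<times> X. L p = 1 \<and> M p = 1}"
    by (subst sum.inter_filter[symmetric]) (use assms(1) in simp_all)
  finally show ?thesis .
qed

text \<open>Here \<open>f\<close> and \<open>g\<close> stand for the bijections of an isotopy on the
  two coordinates that are free within a layer.\<close>

lemma num_ones_bij:
  assumes "bij_betw f X Y" "bij_betw g X Y" "\<And>x y. x \<in> X \<Longrightarrow> y \<in> X \<Longrightarrow> M (f x, g y) = L (x, y)"
  shows "num_ones Y M = num_ones X L"
proof -
  have "bij_betw (map_prod f g) (X \<times> X) (Y \<times> Y)"
    using assms(1,2) by (rule bij_betw_map_prod)
  then have "bij_betw (map_prod f g) {p \<in> X \<times> X. L p = 1} {p \<in> Y \<times> Y. M p = 1}"
    by (rule bij_betw_Collect) (use assms(3) in auto)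
  from bij_betw_same_card[OF this] show ?thesis
    by (simp add: num_ones_def)
qed

lemma scalar_product_bij:
  assumes "bij_betw f X Y" "bij_betw g X Y"
    and "\<And>x y. x \<in> X \<Longrightarrow> y \<in> X \<Longrightarrow> M (f x, g y) = L (x, y)"
    and "\<And>x y. x \<in> X \<Longrightarrow> y \<in> X \<Longrightarrow> M' (f x, g y) = L' (x, y)"
  shows "scalar_product Y M M' = scalar_product X L L'"
proof -
  have "bij_betw (map_prod f g) (X \<times> X) (Y \<times> Y)"
    using assms(1,2) by (rule bij_betw_map_prod)
  from sum.reindex_bij_betw[OF this, of "\<lambda>p. M p * M' p"]
  have "scalar_product Y M M' = (\<Sum>p\<in>X \<times> X. M (map_prod f g p) * M' (map_prod f g p))"
    by (simp add: scalar_product_def)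
  also have "\<dots> = scalar_product X L L'"
    unfolding scalar_product_def using assms(3,4) by (intro sum.cong) auto
  finally show ?thesis .
qed

text \<open>The bijection on the fixed coordinate matches the layers, and being well defined it
  takes distinct layers of \<open>B\<close> back to distinct layers of \<open>A\<close>; the other
  two bijections reindex the positions inside a layer. This carries the parameters of
  \<open>A\<close> over to the cube of a development.\<close>

lemma isotopic_cubes:
  assumes "A \<in> cubes X v k l" "isotopic X A Y B"
  shows "B \<in> cubes Y v k l"
proof -
  obtain \<alpha> \<beta> \<gamma> where bij: "bij_betw \<alpha> X Y" "bij_betw \<beta> X Y" "bij_betw \<gamma> X Y"
    and B: "\<And>x y z. x \<in> X \<Longrightarrow> y \<in> X \<Longrightarrow> z \<in> X \<Longrightarrow> B (\<alpha> x, \<beta> y, \<gamma> z) = A (x, y, z)"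
    using assms(2) unfolding isotopic_def by blast
  have im: "\<alpha> ` X = Y" "\<beta> ` X = Y" "\<gamma> ` X = Y"
    using bij by (auto simp: bij_betw_def)
  have A: "A \<in> X \<times> X \<times> X \<rightarrow> {0, 1}" "finite X" "card X = v"
    and k: "\<And>a. a \<in> X \<Longrightarrow> num_ones X (layer1 A a) = k"
      "\<And>a. a \<in> X \<Longrightarrow> num_ones X (layer2 A a) = k"
      "\<And>a. a \<in> X \<Longrightarrow> num_ones X (layer3 A a) = k"
    and l: "\<And>a b. a \<in> X \<Longrightarrow> b \<in> X \<Longrightarrow> a \<noteq> b \<Longrightarrow> scalar_product X (layer1 A a) (layer1 A b) = l"
      "\<And>a b. a \<in> X \<Longrightarrow> b \<in> X \<Longrightarrow> a \<noteq> b \<Longrightarrow> scalar_product X (layer2 A a) (layer2 A b) = l"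
      "\<And>a b. a \<in> X \<Longrightarrow> b \<in> X \<Longrightarrow> a \<noteq> b \<Longrightarrow> scalar_product X (layer3 A a) (layer3 A b) = l"
    using assms(1) unfolding cubes_def by auto
  have "B \<in> Y \<times> Y \<times> Y \<rightarrow> {0, 1}"
  proof
    fix p assume "p \<in> Y \<times> Y \<times> Y"
    then obtain x y z where "x \<in> X" "y \<in> X" "z \<in> X" "p = (\<alpha> x, \<beta> y, \<gamma> z)"
      using im by blast
    with A(1) B[of x y z] show "B p \<in> {0, 1}"
      by auto
  qed
  moreover have "finite Y" "card Y = v"
    using A bij_betw_finite[OF bij(1)] bij_betw_same_card[OF bij(1)] by simp_all
  moreover have "num_ones Y (layer1 B a) = k" if a: "a \<in> Y" for a
  proof -
    obtain x where "x \<in> X" "a = \<alpha> x" using a im(1) by blast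
    then show ?thesis
      using num_ones_bij[OF bij(2,3), of "layer1 B a" "layer1 A x"] B k
      by (simp add: layer1_def)
  qed
  moreover have "num_ones Y (layer2 B a) = k" if a: "a \<in> Y" for a
  proof -
    obtain x where "x \<in> X" "a = \<beta> x" using a im(2) by blast
    then show ?thesis
      using num_ones_bij[OF bij(1,3), of "layer2 B a" "layer2 A x"] B k
      by (simp add: layer2_def)
  qed
  moreover have "num_ones Y (layer3 B a) = k" if a: "a \<in> Y" for a
  proof -
    obtain x where "x \<in> X" "a = \<gamma> x" using a im(3) by blast
    then show ?thesis
      using num_ones_bij[OF bij(1,2), of "layer3 B a" "layer3 A x"] B k
      by (simp add: layer3_def)
  qed
  moreover have "scalar_product Y (layer1 B a) (layer1 B b) = l"
    if ab: "a \<in> Y" "b \<in> Y" "a \<noteq> b" for a b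
  proof -
    obtain x y where "x \<in> X" "a = \<alpha> x" "y \<in> X" "b = \<alpha> y"
      using ab im(1) by blast
    then show ?thesis
      using scalar_product_bij[OF bij(2,3), of "layer1 B a" "layer1 A x" "layer1 B b" "layer1 A y"]
        B l(1)[of x y] ab
      by (auto simp: layer1_def)
  qed
  moreover have "scalar_product Y (layer2 B a) (layer2 B b) = l"
    if ab: "a \<in> Y" "b \<in> Y" "a \<noteq> b" for a b
  proof -
    obtain x y where "x \<in> X" "a = \<beta> x" "y \<in> X" "b = \<beta> y"
      using ab im(2) by blast
    then show ?thesis
      using scalar_product_bij[OF bij(1,3), of "layer2 B a" "layer2 A x" "layer2 B b" "layer2 A y"]
        B l(2)[of x y] ab
      by (auto simp: layer2_def)
  qed
  moreover have "scalar_product Y (layer3 B a) (layer3 B b) = l"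
    if ab: "a \<in> Y" "b \<in> Y" "a \<noteq> b" for a b
  proof -
    obtain x y where "x \<in> X" "a = \<gamma> x" "y \<in> X" "b = \<gamma> y"
      using ab im(3) by blast
    then show ?thesis
      using scalar_product_bij[OF bij(1,2), of "layer3 B a" "layer3 A x" "layer3 B b" "layer3 A y"]
        B l(3)[of x y] ab
      by (auto simp: layer3_def)
  qed
  ultimately show ?thesis
    unfolding cubes_def by simp
qed

section \<open>The difference set equations from layer counts\<close>

text \<open>For each direction, the common ones of the layers at \<open>g\<close> and at
  \<open>\<one>\<close> correspond to the pairs in \<open>D \<times> D\<close> with difference
  \<open>g\<close>: direction 3 gives the condition on left quotients in both components, directions
  1 and 2 give the conditions with equal second and equal first components.\<close>

lemma (in group) difference_set3_if_dev_cube: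
  assumes D: "D \<subseteq> carrier G \<times> carrier G"
    and cube: "indicator (dev G D) \<in> cubes (carrier G) v k l"
  shows "difference_set3 G v k l D"
proof -
  let ?B = "indicator (dev G D) :: 'a \<times> 'a \<times> 'a \<Rightarrow> nat"
  let ?C = "carrier G \<times> carrier G"
  have fin: "finite (carrier G)" and order: "order G = v"
    and k: "num_ones (carrier G) (layer3 ?B \<one>) = k"
    and l1: "\<And>a b. a \<in> carrier G \<Longrightarrow> b \<in> carrier G \<Longrightarrow> a \<noteq> b \<Longrightarrow>
      scalar_product (carrier G) (layer1 ?B a) (layer1 ?B b) = l"
    and l2: "\<And>a b. a \<in> carrier G \<Longrightarrow> b \<in> carrier G \<Longrightarrow> a \<noteq> b \<Longrightarrow>
      scalar_product (carrier G) (layer2 ?B a) (layer2 ?B b) = l"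
    and l3: "\<And>a b. a \<in> carrier G \<Longrightarrow> b \<in> carrier G \<Longrightarrow> a \<noteq> b \<Longrightarrow>
      scalar_product (carrier G) (layer3 ?B a) (layer3 ?B b) = l"
    using cube unfolding cubes_def order_def by auto
  have B: "?B (a, b, c) = Suc 0 \<longleftrightarrow> (a \<otimes> inv c, b \<otimes> inv c) \<in> D"
    if "a \<in> carrier G" "b \<in> carrier G" "c \<in> carrier G" for a b c
    using mem_dev_iff[OF D that] by (simp add: indicator_def)
  have dD: "x \<in> carrier G \<and> y \<in> carrier G" if "(x, y) \<in> D" for x y
    using D that by auto
  \<comment> \<open>At third coordinate \<open>\<one>\<close> nothing is translated, so this layer
    is \<open>D\<close> itself and its number of ones is the size of \<open>D\<close>.\<close>
  have "{p \<in> ?C. layer3 ?B \<one> p = 1} = D"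
    using D B by (auto simp: layer3_def)
  then have card: "card D = k"
    using k by (simp add: num_ones_def)
  \<comment> \<open>In this form and the next, each difference condition expresses \<open>x\<close>
    through \<open>x'\<close> and \<open>g\<close>, so a pair of elements of \<open>D\<close> can be
    rebuilt from its second element.\<close>
  have solve: "inv x \<otimes> x' = g \<longleftrightarrow> x = x' \<otimes> inv g"
    if "x \<in> carrier G" "x' \<in> carrier G" "g \<in> carrier G" for x x' g
    using that by (metis inv_solve_left inv_solve_right m_closed inv_closed)
  have solve': "x \<otimes> inv x' = g \<longleftrightarrow> x = g \<otimes> x'"
    if "x \<in> carrier G" "x' \<in> carrier G" "g \<in> carrier G" for x x' g
    using that by (metis inv_solve_right)
  have diag: "card {((x, y), (x', y')) \<in> D \<times> D. inv x \<otimes> x' = g \<and> inv y \<otimes> y' = g} = l"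
    if g: "g \<in> carrier G" "g \<noteq> \<one>" for g
  proof -
    let ?P = "{p \<in> ?C. layer3 ?B g p = 1 \<and> layer3 ?B \<one> p = 1}"
    let ?Q = "{((x, y), (x', y')) \<in> D \<times> D. inv x \<otimes> x' = g \<and> inv y \<otimes> y' = g}"
    have Q: "((x, y), (x', y')) \<in> ?Q \<longleftrightarrow>
        (x, y) \<in> D \<and> (x', y') \<in> D \<and> x = x' \<otimes> inv g \<and> y = y' \<otimes> inv g" for x y x' y'
    proof (cases "(x, y) \<in> D \<and> (x', y') \<in> D")
      case True
      then show ?thesis
        using solve[of x x' g] solve[of y y' g] g dD[of x y] dD[of x' y'] by simp
    qed auto
    have P: "(a, b) \<in> ?P \<longleftrightarrow> (a \<otimes> inv g, b \<otimes> inv g) \<in> D \<and> (a, b) \<in> D" for a b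
      using g dD by (auto simp: layer3_def B)
    \<comment> \<open>A one at \<open>(a, b)\<close> in layer \<open>g\<close> puts the shifted pair
      in \<open>D\<close>, and a one in layer \<open>\<one>\<close> puts \<open>(a, b)\<close>
      itself there. The left quotient of the two is \<open>g\<close> in both components, and
      \<open>snd\<close> recovers the position.\<close>
    have "bij_betw (\<lambda>(a, b). ((a \<otimes> inv g, b \<otimes> inv g), (a, b))) ?P ?Q"
    proof (rule bij_betw_byWitness[where f' = snd])
      show "(\<lambda>(a, b). ((a \<otimes> inv g, b \<otimes> inv g), (a, b))) ` ?P \<subseteq> ?Q"
      proof (rule image_subsetI)
        fix p assume "p \<in> ?P"
        moreover obtain a b where "p = (a, b)" by (cases p)
        ultimately show "(\<lambda>(a, b). ((a \<otimes> inv g, b \<otimes> inv g), (a, b))) p \<in> ?Q"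
          using P[of a b] by (auto simp only: Q case_prod_conv)
      qed
      show "\<forall>q\<in>?Q. (\<lambda>(a, b). ((a \<otimes> inv g, b \<otimes> inv g), (a, b))) (snd q) = q"
      proof
        fix q assume q: "q \<in> ?Q"
        obtain x y x' y' where q': "q = ((x, y), (x', y'))" by (metis surj_pair)
        from q show "(\<lambda>(a, b). ((a \<otimes> inv g, b \<otimes> inv g), (a, b))) (snd q) = q"
          by (auto simp only: Q q' snd_conv case_prod_conv)
      qed
      show "snd ` ?Q \<subseteq> ?P"
      proof (rule image_subsetI)
        fix q assume q: "q \<in> ?Q"
        obtain x y x' y' where q': "q = ((x, y), (x', y'))" by (metis surj_pair)
        from q show "snd q \<in> ?P"
          by (auto simp only: P Q q' snd_conv)
      qed
    qed auto
    then have "card ?Q = card ?P"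
      by (rule bij_betw_same_card[symmetric])
    also have "\<dots> = scalar_product (carrier G) (layer3 ?B g) (layer3 ?B \<one>)"
      by (rule scalar_product_eq_card[symmetric, OF fin])
        (auto simp: layer3_def indicator_def)
    finally show ?thesis
      using l3 g by simp
  qed
  have fst: "card {((x, y), (x', y')) \<in> D \<times> D. x \<otimes> inv x' = g \<and> y = y'} = l"
    if g: "g \<in> carrier G" "g \<noteq> \<one>" for g
  proof -
    let ?P = "{p \<in> ?C. layer1 ?B g p = 1 \<and> layer1 ?B \<one> p = 1}"
    let ?Q = "{((x, y), (x', y')) \<in> D \<times> D. x \<otimes> inv x' = g \<and> y = y'}"
    \<comment> \<open>The two halves are the members of \<open>D\<close> that account for the ones
      at \<open>(g, b, c)\<close> and \<open>(\<one>, b, c)\<close>. Their second components agree,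
      and in the right quotient of the first components \<open>c\<close> cancels, leaving
      \<open>g\<close>.\<close>
    let ?f = "\<lambda>(b, c). ((g \<otimes> inv c, b \<otimes> inv c), (inv c, b \<otimes> inv c))"
    have Q: "((x, y), (x', y')) \<in> ?Q \<longleftrightarrow>
        (x, y) \<in> D \<and> (x', y') \<in> D \<and> x = g \<otimes> x' \<and> y = y'" for x y x' y'
    proof (cases "(x, y) \<in> D \<and> (x', y') \<in> D")
      case True
      then show ?thesis
        using solve'[of x x' g] g dD[of x y] dD[of x' y'] by simp
    qed auto
    have P: "(a, c) \<in> ?P \<longleftrightarrow> a \<in> carrier G \<and> c \<in> carrier G \<and> (g \<otimes> inv c, a \<otimes> inv c) \<in> D \<and> (inv c, a \<otimes> inv c) \<in> D" for a c
      using g by (auto simp: layer1_def B)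
    have "bij_betw ?f ?P ?Q"
    \<comment> \<open>The witness solves \<open>x' = inv c\<close> and
      \<open>y' = b \<otimes> inv c\<close> for \<open>(b, c)\<close>.\<close>
    proof (rule bij_betw_byWitness[where f' = "\<lambda>(_, x', y'). (y' \<otimes> inv x', inv x')"])
      show "\<forall>p\<in>?P. (\<lambda>(_, x', y'). (y' \<otimes> inv x', inv x')) (?f p) = p"
        by (auto simp: m_assoc)
      show "?f ` ?P \<subseteq> ?Q"
      proof (rule image_subsetI)
        fix p assume "p \<in> ?P"
        moreover obtain a c where "p = (a, c)" by (cases p)
        ultimately show "?f p \<in> ?Q"
          using P[of a c] by (auto simp only: Q case_prod_conv)
      qed
      show "\<forall>q\<in>?Q. ?f ((\<lambda>(_, x', y'). (y' \<otimes> inv x', inv x')) q) = q"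
      proof
        fix q assume q: "q \<in> ?Q"
        obtain x y x' y' where q': "q = ((x, y), (x', y'))" by (metis surj_pair)
        from q have "(x', y') \<in> D \<and> x = g \<otimes> x' \<and> y = y'"
          by (auto simp only: Q q')
        then show "?f ((\<lambda>(_, x', y'). (y' \<otimes> inv x', inv x')) q) = q"
          using dD[of x' y'] by (simp add: q' m_assoc)
      qed
      show "(\<lambda>(_, x', y'). (y' \<otimes> inv x', inv x')) ` ?Q \<subseteq> ?P"
      proof (rule image_subsetI)
        fix q assume q: "q \<in> ?Q"
        obtain x y x' y' where q': "q = ((x, y), (x', y'))" by (metis surj_pair)
        from q have "(x, y) \<in> D \<and> (x', y') \<in> D \<and> x = g \<otimes> x' \<and> y = y'"
          by (auto simp only: Q q')
        then show "(\<lambda>(_, x', y'). (y' \<otimes> inv x', inv x')) q \<in> ?P"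
          using dD[of x' y'] by (simp only: P q' case_prod_conv) (auto simp: m_assoc)
      qed
    qed
    then have "card ?Q = card ?P"
      by (rule bij_betw_same_card[symmetric])
    also have "\<dots> = scalar_product (carrier G) (layer1 ?B g) (layer1 ?B \<one>)"
      by (rule scalar_product_eq_card[symmetric, OF fin])
        (auto simp: layer1_def indicator_def)
    finally show ?thesis
      using l1 g by simp
  qed
  have snd: "card {((x, y), (x', y')) \<in> D \<times> D. x = x' \<and> y \<otimes> inv y' = g} = l"
    if g: "g \<in> carrier G" "g \<noteq> \<one>" for g
  proof -
    let ?P = "{p \<in> ?C. layer2 ?B g p = 1 \<and> layer2 ?B \<one> p = 1}"
    let ?Q = "{((x, y), (x', y')) \<in> D \<times> D. x = x' \<and> y \<otimes> inv y' = g}"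
    \<comment> \<open>As for the first direction with the roles of the two components exchanged: the
      ones at \<open>(a, g, c)\<close> and \<open>(a, \<one>, c)\<close> yield this pair, and the
      inverse map solves \<open>y' = inv c\<close> and
      \<open>x' = a \<otimes> inv c\<close>.\<close>
    let ?f = "\<lambda>(a, c). ((a \<otimes> inv c, g \<otimes> inv c), (a \<otimes> inv c, inv c))"
    have Q: "((x, y), (x', y')) \<in> ?Q \<longleftrightarrow>
        (x, y) \<in> D \<and> (x', y') \<in> D \<and> x = x' \<and> y = g \<otimes> y'" for x y x' y'
    proof (cases "(x, y) \<in> D \<and> (x', y') \<in> D")
      case True
      then show ?thesis
        using solve'[of y y' g] g dD[of x y] dD[of x' y'] by simp
    qed auto
    have P: "(a, c) \<in> ?P \<longleftrightarrow> a \<in> carrier G \<and> c \<in> carrier G \<and> (a \<otimes> inv c, g \<otimes> inv c) \<in> D \<and> (a \<otimes> inv c, inv c) \<in> D" for a c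
      using g by (auto simp: layer2_def B)
    have "bij_betw ?f ?P ?Q"
    proof (rule bij_betw_byWitness[where f' = "\<lambda>(_, x', y'). (x' \<otimes> inv y', inv y')"])
      show "\<forall>p\<in>?P. (\<lambda>(_, x', y'). (x' \<otimes> inv y', inv y')) (?f p) = p"
        by (auto simp: m_assoc)
      show "?f ` ?P \<subseteq> ?Q"
      proof (rule image_subsetI)
        fix p assume "p \<in> ?P"
        moreover obtain a c where "p = (a, c)" by (cases p)
        ultimately show "?f p \<in> ?Q"
          using P[of a c] by (auto simp only: Q case_prod_conv)
      qed
      show "\<forall>q\<in>?Q. ?f ((\<lambda>(_, x', y'). (x' \<otimes> inv y', inv y')) q) = q"
      proof
        fix q assume q: "q \<in> ?Q"
        obtain x y x' y' where q': "q = ((x, y), (x', y'))" by (metis surj_pair)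
        from q have "(x', y') \<in> D \<and> x = x' \<and> y = g \<otimes> y'"
          by (auto simp only: Q q')
        then show "?f ((\<lambda>(_, x', y'). (x' \<otimes> inv y', inv y')) q) = q"
          using dD[of x' y'] by (simp add: q' m_assoc)
      qed
      show "(\<lambda>(_, x', y'). (x' \<otimes> inv y', inv y')) ` ?Q \<subseteq> ?P"
      proof (rule image_subsetI)
        fix q assume q: "q \<in> ?Q"
        obtain x y x' y' where q': "q = ((x, y), (x', y'))" by (metis surj_pair)
        from q have "(x, y) \<in> D \<and> (x', y') \<in> D \<and> x = x' \<and> y = g \<otimes> y'"
          by (auto simp only: Q q')
        then show "(\<lambda>(_, x', y'). (x' \<otimes> inv y', inv y')) q \<in> ?P"
          using dD[of x' y'] by (simp only: P q' case_prod_conv) (auto simp: m_assoc)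
      qed
    qed
    then have "card ?Q = card ?P"
      by (rule bij_betw_same_card[symmetric])
    also have "\<dots> = scalar_product (carrier G) (layer2 ?B g) (layer2 ?B \<one>)"
      by (rule scalar_product_eq_card[symmetric, OF fin])
        (auto simp: layer2_def indicator_def)
    finally show ?thesis
      using l2 g by simp
  qed
  show ?thesis
    unfolding difference_set3_def using fin order D card diag fst snd by simp
qed

section \<open>The autotopy group\<close>

lemma mult_BijGroup: "f \<in> Bij X \<Longrightarrow> g \<in> Bij X \<Longrightarrow> f \<otimes>\<^bsub>BijGroup X\<^esub> g = compose X f g"
  by (simp add: BijGroup_def)

lemma carrier_BijGroup: "carrier (BijGroup X) = Bij X"
  by (simp add: BijGroup_def)

lemma carrier_Atop:
  "(f, g, h) \<in> carrier (Atop X A) \<longleftrightarrow> f \<in> Bij X \<and> g \<in> Bij X \<and> h \<in> Bij X \<and>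
    (\<forall>x\<in>X. \<forall>y\<in>X. \<forall>z\<in>X. A (f x, g y, h z) = A (x, y, z))"
  by (simp add: Atop_def)

lemma mult_Atop:
  "(f, g, h) \<otimes>\<^bsub>Atop X A\<^esub> (f', g', h') =
    (f \<otimes>\<^bsub>BijGroup X\<^esub> f', g \<otimes>\<^bsub>BijGroup X\<^esub> g', h \<otimes>\<^bsub>BijGroup X\<^esub> h')"
  by (simp add: Atop_def DirProd_def)

text \<open>The autotopies form a subgroup of the threefold product of \<open>BijGroup X\<close>.
  For inverses, the invariance of \<open>A\<close> is applied at the preimages of \<open>x\<close>,
  \<open>y\<close> and \<open>z\<close>.\<close>

lemma group_Atop: "group (Atop X A)"
proof -
  let ?P = "BijGroup X \<times>\<times> BijGroup X \<times>\<times> BijGroup X"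
  interpret P: group ?P
    by (intro DirProd_group group_BijGroup)
  have "subgroup (carrier (Atop X A)) ?P"
  proof (rule P.subgroupI)
    show "carrier (Atop X A) \<subseteq> carrier ?P"
      by (auto simp: Atop_def carrier_BijGroup)
    have "(\<lambda>x\<in>X. x, \<lambda>x\<in>X. x, \<lambda>x\<in>X. x) \<in> carrier (Atop X A)"
      by (simp add: carrier_Atop id_Bij)
    then show "carrier (Atop X A) \<noteq> {}"
      by blast
  next
    fix p assume p: "p \<in> carrier (Atop X A)"
    obtain f g h where p_eq: "p = (f, g, h)"
      by (rule prod_cases3)
    have Bij: "f \<in> Bij X" "g \<in> Bij X" "h \<in> Bij X"
      and A: "\<And>x y z. x \<in> X \<Longrightarrow> y \<in> X \<Longrightarrow> z \<in> X \<Longrightarrow> A (f x, g y, h z) = A (x, y, z)"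
      using p by (simp_all add: p_eq carrier_Atop)
    have inv: "inv_into X f' x \<in> X" "f' (inv_into X f' x) = x" if "f' \<in> Bij X" "x \<in> X" for f' x
      using that Bij_inv_into_mem[of f' X x] by (auto simp: Bij_def bij_betw_inv_into_right)
    have "inv\<^bsub>?P\<^esub> p = (\<lambda>x\<in>X. inv_into X f x, \<lambda>x\<in>X. inv_into X g x, \<lambda>x\<in>X. inv_into X h x)"
      using Bij by (simp add: p_eq carrier_BijGroup inv_BijGroup group_BijGroup DirProd_group)
    moreover have "A (inv_into X f x, inv_into X g y, inv_into X h z) = A (x, y, z)"
      if "x \<in> X" "y \<in> X" "z \<in> X" for x y z
      using A[of "inv_into X f x" "inv_into X g y" "inv_into X h z"]
        inv[OF Bij(1) that(1)] inv[OF Bij(2) that(2)] inv[OF Bij(3) that(3)] by simp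
    ultimately show "inv\<^bsub>?P\<^esub> p \<in> carrier (Atop X A)"
      using Bij by (simp add: carrier_Atop restrict_inv_into_Bij)
  next
    fix p q assume pq: "p \<in> carrier (Atop X A)" "q \<in> carrier (Atop X A)"
    obtain f g h where p_eq: "p = (f, g, h)"
      by (rule prod_cases3)
    obtain f' g' h' where q_eq: "q = (f', g', h')"
      by (rule prod_cases3)
    show "p \<otimes>\<^bsub>?P\<^esub> q \<in> carrier (Atop X A)"
      using pq Bij_imp_funcset[of _ X]
      by (auto simp: p_eq q_eq carrier_Atop mult_BijGroup compose_Bij compose_eq Pi_iff)
  qed
  then have "group (?P\<lparr>carrier := carrier (Atop X A)\<rparr>)"
    by (rule subgroup.subgroup_is_group) (rule P.group_axioms)
  then show ?thesis
    by (simp add: Atop_def)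
qed

section \<open>Coordinates in which a group acts by right translations\<close>

text \<open>Right translation by the inverse of \<open>g\<close>, transported to \<open>X\<close>
  along the coordinate map \<open>f\<close>. The inverse makes
  \<open>g \<mapsto> translation G X f g\<close> a homomorphism for composition of maps, where right
  multiplication by \<open>g\<close> would reverse products. The restriction to \<open>X\<close>
  provides the extensionality that \<open>Bij X\<close> demands.\<close>

definition translation ::
  "('g, 'm) monoid_scheme \<Rightarrow> 'x set \<Rightarrow> ('x \<Rightarrow> 'g) \<Rightarrow> 'g \<Rightarrow> 'x \<Rightarrow> 'x" where
  "translation G X f g = (\<lambda>x\<in>X. inv_into X f (f x \<otimes>\<^bsub>G\<^esub> inv\<^bsub>G\<^esub> g))"

context group
begin

context
  fixes X :: "'x set" and f :: "'x \<Rightarrow> 'a"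
  assumes f: "bij_betw f X (carrier G)"
begin

lemma coordinate_closed: "x \<in> X \<Longrightarrow> f x \<in> carrier G"
  using f by (rule bij_betw_apply)

lemma translation_closed: "x \<in> X \<Longrightarrow> g \<in> carrier G \<Longrightarrow> translation G X f g x \<in> X"
  using bij_betw_apply[OF bij_betw_inv_into[OF f]] coordinate_closed by (simp add: translation_def)

lemma coordinate_translation:
  "x \<in> X \<Longrightarrow> g \<in> carrier G \<Longrightarrow> f (translation G X f g x) = f x \<otimes> inv g"
  using bij_betw_inv_into_right[OF f] coordinate_closed by (simp add: translation_def)

lemma coordinate_eq_iff: "x \<in> X \<Longrightarrow> y \<in> X \<Longrightarrow> f x = f y \<longleftrightarrow> x = y"
  using f by (auto simp: bij_betw_def inj_on_def)

text \<open>On \<open>X\<close> both sides have the same \<open>f\<close>-coordinate, by inversion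
  of a product, and \<open>f\<close> is injective there; outside \<open>X\<close> both are
  undefined.\<close>

lemma translation_mult:
  assumes "g \<in> carrier G" "h \<in> carrier G"
  shows "translation G X f (g \<otimes> h) = compose X (translation G X f g) (translation G X f h)"
proof
  fix x
  show "translation G X f (g \<otimes> h) x = compose X (translation G X f g) (translation G X f h) x"
  proof (cases "x \<in> X")
    case True
    then have "f (translation G X f (g \<otimes> h) x) = f (translation G X f g (translation G X f h x))"
      using assms
      by (simp add: coordinate_translation translation_closed coordinate_closed inv_mult_group m_assoc)
    then show ?thesis
      using True assms by (simp add: coordinate_eq_iff translation_closed compose_eq)
  qed (simp add: translation_def compose_def)
qed

lemma translation_Bij:
  assumes "g \<in> carrier G"
  shows "translation G X f g \<in> Bij X"
proof -
  have "translation G X f (inv h) (translation G X f h x) = x" if "h \<in> carrier G" "x \<in> X" for h x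
  proof -
    have "f (translation G X f (inv h) (translation G X f h x)) = f x"
      using that by (simp add: coordinate_translation translation_closed coordinate_closed m_assoc)
    then show ?thesis
      using that by (simp add: coordinate_eq_iff translation_closed)
  qed
  \<comment> \<open>The two instances say that the translations by \<open>g\<close> and by
    \<open>inv g\<close> undo each other in either order.\<close>
  note this[of g] this[of "inv g"]
  then have "bij_betw (translation G X f g) X X"
    using assms
    by (intro bij_betw_byWitness[where f' = "translation G X f (inv g)"])
      (auto simp: translation_closed)
  then show ?thesis
    by (simp add: Bij_def translation_def)
qed

text \<open>In coordinates the condition reads \<open>f x' = f x \<otimes> inv g\<close>, an
  equation with exactly one solution \<open>g\<close>. It yields sharp transitivity and also the
  faithfulness of the action.\<close>

lemma ex1_translation:
  assumes "x \<in> X" "x' \<in> X"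
  shows "\<exists>!g. g \<in> carrier G \<and> translation G X f g x = x'"
proof -
  have "translation G X f g x = x' \<longleftrightarrow> g = inv (f x') \<otimes> f x" if "g \<in> carrier G" for g
  proof -
    have "translation G X f g x = x' \<longleftrightarrow> f x' = f x \<otimes> inv g"
      using coordinate_translation[OF assms(1) that] coordinate_eq_iff[of "translation G X f g x" x']
        translation_closed[OF assms(1) that] assms(2) by auto
    also have "\<dots> \<longleftrightarrow> f x = f x' \<otimes> g"
      by (rule inv_solve_right) (use that assms coordinate_closed in simp_all)
    also have "\<dots> \<longleftrightarrow> g = inv (f x') \<otimes> f x"
      by (rule inv_solve_left[symmetric]) (use that assms coordinate_closed in simp_all)
    finally show ?thesis .
  qed
  then show ?thesis
    using assms coordinate_closed by (intro ex1I[of _ "inv (f x') \<otimes> f x"]) auto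
qed

end

text \<open>Fix a base point \<open>x0\<close>. Each point is \<open>act h' x0\<close> for a unique
  \<open>h'\<close>, and its coordinate is taken to be \<open>inv (\<phi> h')\<close>. The abstract
  homomorphism \<open>act\<close> lets the same statement serve all three coordinate
  projections.\<close>

lemma sharply_transitive_orbit_bij:
  fixes X :: "'x set" and K :: "('h, 'n) monoid_scheme"
  assumes \<phi>: "\<phi> \<in> iso K G" and K: "group K"
    and act: "act \<in> hom K (BijGroup X)"
    and st: "sharply_transitive X (carrier K) act" and "X \<noteq> {}"
  obtains f where "bij_betw f X (carrier G)"
    and "\<And>h x. h \<in> carrier K \<Longrightarrow> x \<in> X \<Longrightarrow> f (act h x) = f x \<otimes> inv (\<phi> h)"
proof -
  interpret K: group K by fact
  interpret \<phi>: group_hom K G \<phi>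
    using \<phi> by unfold_locales (simp add: iso_def)
  obtain x0 where x0: "x0 \<in> X"
    using \<open>X \<noteq> {}\<close> by blast
  have Bij: "act h \<in> Bij X" if "h \<in> carrier K" for h
    using act that by (auto simp: hom_def carrier_BijGroup)
  have closed: "act h x \<in> X" if "h \<in> carrier K" "x \<in> X" for h x
    using Bij_imp_funcset[OF Bij] that by blast
  have mult: "act (h \<otimes>\<^bsub>K\<^esub> h') x = act h (act h' x)"
    if "h \<in> carrier K" "h' \<in> carrier K" "x \<in> X" for h h' x
    using hom_mult[OF act] that Bij by (simp add: mult_BijGroup compose_eq)
  have ex1: "\<exists>!h. h \<in> carrier K \<and> act h x0 = x" if "x \<in> X" for x
    using st x0 that by (auto simp: sharply_transitive_def)
  define e where "e h = act h x0" for h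
  have e: "bij_betw e (carrier K) X"
  proof (rule bij_betw_imageI)
    show "inj_on e (carrier K)"
      using ex1 closed x0 by (metis (mono_tags, lifting) inj_onI e_def)
    show "e ` carrier K = X"
      using ex1 closed x0 unfolding e_def by blast
  qed
  have "bij_betw (m_inv G) (carrier G) (carrier G)"
    by (rule bij_betw_byWitness[where f' = "m_inv G"]) auto
  moreover have "bij_betw \<phi> (carrier K) (carrier G)"
    using \<phi> by (simp add: iso_def)
  \<comment> \<open>Acting by \<open>h\<close> replaces \<open>h'\<close> by its left multiple by
    \<open>h\<close>; the final inversion turns this into right multiplication by
    \<open>inv (\<phi> h)\<close>.\<close>
  ultimately have "bij_betw (m_inv G \<circ> (\<phi> \<circ> inv_into (carrier K) e)) X (carrier G)"
    using bij_betw_inv_into[OF e] by (blast intro: bij_betw_trans)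
  moreover have "(m_inv G \<circ> (\<phi> \<circ> inv_into (carrier K) e)) (act h x) =
      (m_inv G \<circ> (\<phi> \<circ> inv_into (carrier K) e)) x \<otimes> inv (\<phi> h)"
    if h: "h \<in> carrier K" and "x \<in> X" for h x
  proof -
    obtain h' where h': "h' \<in> carrier K" "x = e h'"
      using \<open>x \<in> X\<close> e by (auto simp: bij_betw_def)
    have "act h x = e (h \<otimes>\<^bsub>K\<^esub> h')"
      using h h' x0 by (simp add: e_def mult)
    then show ?thesis
      using h h' bij_betw_inv_into_left[OF e] by (simp add: inv_mult_group)
  qed
  ultimately show thesis
    by (rule that)
qed

end

section \<open>The two implications and their combination\<close>

text \<open>The required subgroup is the image of \<open>G\<close> under \<open>\<tau>\<close>,
  which translates all three coordinates simultaneously by the same group element, each read through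
  its own bijection of the isotopy.\<close>

lemma (in group) sharply_transitive_subgroup_if_isotopic_dev:
  assumes D: "D \<subseteq> carrier G \<times> carrier G"
    and isotopic: "isotopic X A (carrier G) (indicator (dev G D))" and "X \<noteq> {}"
  shows "\<exists>H. subgroup H (Atop X A) \<and> (Atop X A)\<lparr>carrier := H\<rparr> \<cong> G \<and>
    sharply_transitive X H (\<lambda>(\<alpha>, \<beta>, \<gamma>). \<alpha>) \<and>
    sharply_transitive X H (\<lambda>(\<alpha>, \<beta>, \<gamma>). \<beta>) \<and>
    sharply_transitive X H (\<lambda>(\<alpha>, \<beta>, \<gamma>). \<gamma>)"
proof -
  interpret T: group "Atop X A" by (rule group_Atop)
  obtain \<alpha> \<beta> \<gamma> where \<alpha>: "bij_betw \<alpha> X (carrier G)" and \<beta>: "bij_betw \<beta> X (carrier G)"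
    and \<gamma>: "bij_betw \<gamma> X (carrier G)"
    and A: "\<And>x y z. x \<in> X \<Longrightarrow> y \<in> X \<Longrightarrow> z \<in> X \<Longrightarrow>
      indicator (dev G D) (\<alpha> x, \<beta> y, \<gamma> z) = A (x, y, z)"
    using isotopic unfolding isotopic_def by blast
  define \<tau> where "\<tau> g = (translation G X \<alpha> g, translation G X \<beta> g, translation G X \<gamma> g)" for g
  \<comment> \<open>Through the isotopy, \<open>\<tau> g\<close> becomes the common right
    translation by \<open>inv g\<close>, which preserves the development.\<close>
  have \<tau>_closed: "\<tau> g \<in> carrier (Atop X A)" if g: "g \<in> carrier G" for g
  proof -
    have "A (translation G X \<alpha> g x, translation G X \<beta> g y, translation G X \<gamma> g z) = A (x, y, z)"
      if x: "x \<in> X" and y: "y \<in> X" and z: "z \<in> X" for x y z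
      using dev_right_translate_iff[OF D, of "\<alpha> x" "\<beta> y" "\<gamma> z" "inv g"] g
        coordinate_closed[OF \<alpha> x] coordinate_closed[OF \<beta> y] coordinate_closed[OF \<gamma> z]
      by (simp add: translation_closed \<alpha> \<beta> \<gamma> x y z coordinate_translation indicator_def
          flip: A)
    then show ?thesis
      using g \<alpha> \<beta> \<gamma> by (simp add: \<tau>_def carrier_Atop translation_Bij)
  qed
  have \<tau>_hom: "\<tau> \<in> hom G (Atop X A)"
    using \<tau>_closed \<alpha> \<beta> \<gamma>
    by (simp add: hom_def \<tau>_def mult_Atop mult_BijGroup translation_Bij translation_mult)
  interpret \<tau>: group_hom G "Atop X A" \<tau>
    by unfold_locales (rule \<tau>_hom)
  let ?H = "\<tau> ` carrier G"
  \<comment> \<open>The images of a single point under the first component already distinguish the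
    group elements.\<close>
  have "inj_on \<tau> (carrier G)"
  proof (rule inj_onI)
    fix g h assume gh: "g \<in> carrier G" "h \<in> carrier G" "\<tau> g = \<tau> h"
    obtain x where x: "x \<in> X"
      using \<open>X \<noteq> {}\<close> by blast
    have "translation G X \<alpha> g x = translation G X \<alpha> h x"
      using gh(3) by (simp add: \<tau>_def)
    then show "g = h"
      using ex1_translation[OF \<alpha> x translation_closed[OF \<alpha> x gh(1)]] gh(1,2) by metis
  qed
  then have "\<tau> \<in> iso G ((Atop X A)\<lparr>carrier := ?H\<rparr>)"
    using \<tau>_hom by (auto simp: iso_def hom_def bij_betw_def)
  then have "(Atop X A)\<lparr>carrier := ?H\<rparr> \<cong> G"
    by (intro iso_sym is_isoI)
  \<comment> \<open>Stated for an arbitrary coordinate bijection \<open>f\<close> and projection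
    \<open>act\<close>, so that it can be instantiated once per coordinate.\<close>
  moreover have st: "sharply_transitive X ?H act"
    if f: "bij_betw f X (carrier G)" and act: "\<And>g. act (\<tau> g) = translation G X f g" for f act
    unfolding sharply_transitive_def
  proof (intro ballI)
    fix x x' assume "x \<in> X" "x' \<in> X"
    from ex1_translation[OF f this]
    obtain g where g: "g \<in> carrier G" "translation G X f g x = x'"
      and unique: "\<And>h. h \<in> carrier G \<Longrightarrow> translation G X f h x = x' \<Longrightarrow> h = g"
      by blast
    show "\<exists>!h. h \<in> ?H \<and> act h x = x'"
    proof (rule ex1I[of _ "\<tau> g"])
      show "\<tau> g \<in> ?H \<and> act (\<tau> g) x = x'"
        using g by (simp add: act)
      fix h assume "h \<in> ?H \<and> act h x = x'"
      then obtain h' where "h' \<in> carrier G" "h = \<tau> h'" "translation G X f h' x = x'"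
        using act by fastforce
      with unique show "h = \<tau> g"
        by blast
    qed
  qed
  have "sharply_transitive X ?H (\<lambda>(\<alpha>, \<beta>, \<gamma>). \<alpha>)" "sharply_transitive X ?H (\<lambda>(\<alpha>, \<beta>, \<gamma>). \<beta>)"
    "sharply_transitive X ?H (\<lambda>(\<alpha>, \<beta>, \<gamma>). \<gamma>)"
    by (rule st[OF \<alpha>], simp add: \<tau>_def) (rule st[OF \<beta>], simp add: \<tau>_def,
      rule st[OF \<gamma>], simp add: \<tau>_def)
  ultimately show ?thesis
    using \<tau>.img_is_subgroup by blast
qed

text \<open>The three orbit coordinates are built from the same isomorphism \<open>\<phi>\<close>,
  so an element \<open>p\<close> of \<open>H\<close> right-translates all of them by the same
  \<open>inv (\<phi> p)\<close>. Invariance under \<open>H\<close> then determines the cube from a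
  single layer.\<close>

lemma (in group) difference_set3_if_sharply_transitive_subgroup:
  assumes cube: "A \<in> cubes X v k l" and "X \<noteq> {}"
    and H: "subgroup H (Atop X A)" and iso_G: "(Atop X A)\<lparr>carrier := H\<rparr> \<cong> G"
    and st: "sharply_transitive X H (\<lambda>(\<alpha>, \<beta>, \<gamma>). \<alpha>)"
      "sharply_transitive X H (\<lambda>(\<alpha>, \<beta>, \<gamma>). \<beta>)"
      "sharply_transitive X H (\<lambda>(\<alpha>, \<beta>, \<gamma>). \<gamma>)"
  shows "\<exists>D. difference_set3 G v k l D \<and> isotopic X A (carrier G) (indicator (dev G D))"
proof -
  interpret T: group "Atop X A" by (rule group_Atop)
  let ?K = "(Atop X A)\<lparr>carrier := H\<rparr>"
  obtain \<phi> where \<phi>: "\<phi> \<in> iso ?K G"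
    using iso_G by (auto simp: is_iso_def)
  have K: "group ?K"
    using H T.group_axioms by (rule subgroup.subgroup_is_group)
  have sub: "H \<subseteq> carrier (Atop X A)"
    using H by (rule subgroup.subset)
  have memD: "f \<in> Bij X \<and> g \<in> Bij X \<and> h \<in> Bij X" if "(f, g, h) \<in> H" for f g h
    using that sub carrier_Atop by blast
  have hom: "(\<lambda>(\<alpha>, \<beta>, \<gamma>). \<alpha>) \<in> hom ?K (BijGroup X)" "(\<lambda>(\<alpha>, \<beta>, \<gamma>). \<beta>) \<in> hom ?K (BijGroup X)"
    "(\<lambda>(\<alpha>, \<beta>, \<gamma>). \<gamma>) \<in> hom ?K (BijGroup X)"
    by (auto simp: hom_def carrier_BijGroup mult_Atop dest: memD)
  obtain \<alpha> where \<alpha>: "bij_betw \<alpha> X (carrier G)"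
    and \<alpha>_orbit: "\<And>p x. p \<in> carrier ?K \<Longrightarrow> x \<in> X \<Longrightarrow>
      \<alpha> ((\<lambda>(\<alpha>, \<beta>, \<gamma>). \<alpha>) p x) = \<alpha> x \<otimes> inv (\<phi> p)"
    by (rule sharply_transitive_orbit_bij[OF \<phi> K hom(1) _ \<open>X \<noteq> {}\<close>])
      (simp_all add: st)
  have \<alpha>_act: "\<alpha> (f x) = \<alpha> x \<otimes> inv (\<phi> (f, g, h))" if "(f, g, h) \<in> H" "x \<in> X" for f g h x
    using \<alpha>_orbit[of "(f, g, h)" x] that by simp
  obtain \<beta> where \<beta>: "bij_betw \<beta> X (carrier G)"
    and \<beta>_orbit: "\<And>p x. p \<in> carrier ?K \<Longrightarrow> x \<in> X \<Longrightarrow>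
      \<beta> ((\<lambda>(\<alpha>, \<beta>, \<gamma>). \<beta>) p x) = \<beta> x \<otimes> inv (\<phi> p)"
    by (rule sharply_transitive_orbit_bij[OF \<phi> K hom(2) _ \<open>X \<noteq> {}\<close>])
      (simp_all add: st)
  have \<beta>_act: "\<beta> (g x) = \<beta> x \<otimes> inv (\<phi> (f, g, h))" if "(f, g, h) \<in> H" "x \<in> X" for f g h x
    using \<beta>_orbit[of "(f, g, h)" x] that by simp
  obtain \<gamma> where \<gamma>: "bij_betw \<gamma> X (carrier G)"
    and \<gamma>_orbit: "\<And>p x. p \<in> carrier ?K \<Longrightarrow> x \<in> X \<Longrightarrow>
      \<gamma> ((\<lambda>(\<alpha>, \<beta>, \<gamma>). \<gamma>) p x) = \<gamma> x \<otimes> inv (\<phi> p)"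
    by (rule sharply_transitive_orbit_bij[OF \<phi> K hom(3) _ \<open>X \<noteq> {}\<close>])
      (simp_all add: st)
  have \<gamma>_act: "\<gamma> (h x) = \<gamma> x \<otimes> inv (\<phi> (f, g, h))" if "(f, g, h) \<in> H" "x \<in> X" for f g h x
    using \<gamma>_orbit[of "(f, g, h)" x] that by simp
  \<comment> \<open>The layer whose third coordinate is \<open>\<one>\<close> becomes
    \<open>D\<close>, since a development restricts to its generating set there.\<close>
  define z0 where "z0 = inv_into X \<gamma> \<one>"
  have z0: "z0 \<in> X" "\<gamma> z0 = \<one>"
    using bij_betw_apply[OF bij_betw_inv_into[OF \<gamma>]] bij_betw_inv_into_right[OF \<gamma>]
    by (simp_all add: z0_def)
  define D where "D = {(\<alpha> x, \<beta> y) | x y. x \<in> X \<and> y \<in> X \<and> A (x, y, z0) = 1}"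
  have D: "D \<subseteq> carrier G \<times> carrier G"
    using coordinate_closed[OF \<alpha>] coordinate_closed[OF \<beta>] by (auto simp: D_def)
  have D_iff: "(\<alpha> x, \<beta> y) \<in> D \<longleftrightarrow> A (x, y, z0) = 1" if "x \<in> X" "y \<in> X" for x y
    using that coordinate_eq_iff[OF \<alpha>] coordinate_eq_iff[OF \<beta>] by (auto simp: D_def)
  have "indicator (dev G D) (\<alpha> x, \<beta> y, \<gamma> z) = A (x, y, z)"
    if x: "x \<in> X" and y: "y \<in> X" and z: "z \<in> X" for x y z
  proof -
    \<comment> \<open>The element of \<open>H\<close> with \<open>\<phi>\<close>-value
      \<open>\<gamma> z\<close> moves \<open>z\<close> to \<open>z0\<close>. Applying it to
      \<open>(x, y, z)\<close> keeps the entry of \<open>A\<close> and lands in the layer that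
      defines \<open>D\<close>, while in coordinates it divides by \<open>\<gamma> z\<close> exactly
      as \<open>mem_dev_iff\<close> does.\<close>
    have "\<gamma> z \<in> \<phi> ` H"
      using coordinate_closed[OF \<gamma> z] \<phi> by (auto simp: iso_def bij_betw_def)
    then obtain f g h where H': "(f, g, h) \<in> H" and \<phi>_eq: "\<phi> (f, g, h) = \<gamma> z"
      by (metis imageE prod_cases3)
    have closed: "f x \<in> X" "g y \<in> X" "h z \<in> X"
      using memD[OF H'] Bij_imp_funcset x y z by blast+
    have "\<gamma> (h z) = \<gamma> z0"
      using \<gamma>_act[OF H' z] coordinate_closed[OF \<gamma> z] by (simp add: \<phi>_eq z0)
    then have "h z = z0"
      using coordinate_eq_iff[OF \<gamma>] closed z0 by blast
    have "(\<alpha> x, \<beta> y, \<gamma> z) \<in> dev G D \<longleftrightarrow> (\<alpha> (f x), \<beta> (g y)) \<in> D"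
      using mem_dev_iff[OF D coordinate_closed[OF \<alpha> x] coordinate_closed[OF \<beta> y]
          coordinate_closed[OF \<gamma> z]]
      by (simp add: \<alpha>_act[OF H' x] \<beta>_act[OF H' y] \<phi>_eq)
    also have "\<dots> \<longleftrightarrow> A (f x, g y, h z) = 1"
      using D_iff closed \<open>h z = z0\<close> by simp
    also have "A (f x, g y, h z) = A (x, y, z)"
      using subsetD[OF sub H'] x y z by (simp add: carrier_Atop)
    finally have "(\<alpha> x, \<beta> y, \<gamma> z) \<in> dev G D \<longleftrightarrow> A (x, y, z) = 1" .
    \<comment> \<open>Only the entries equal to 1 have been matched so far; with values in
      \<open>{0, 1}\<close> this gives equality of the entries.\<close>
    moreover have "A (x, y, z) \<in> {0, 1}"
      using cube x y z by (intro Pi_mem[of A "X \<times> X \<times> X" "\<lambda>_. {0, 1}"]) (simp_all add: cubes_def)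
    ultimately show ?thesis
      by (auto simp: indicator_def)
  qed
  then have iso: "isotopic X A (carrier G) (indicator (dev G D))"
    unfolding isotopic_def using \<alpha> \<beta> \<gamma> by blast
  moreover have "difference_set3 G v k l D"
    using D isotopic_cubes[OF cube iso] by (rule difference_set3_if_dev_cube)
  ultimately show ?thesis
    by blast
qed

theorem theorem3p6:
  fixes G :: "('g, 'm) monoid_scheme"
    and X :: "'x set"
    and A :: "'x \<times> 'x \<times> 'x \<Rightarrow> nat"
    and v k l :: nat
  assumes "group G" and "finite (carrier G)" and "order G = v"
    and "A \<in> cubes X v k l"
  shows "(\<exists>D. difference_set3 G v k l D \<and>
            isotopic X A (carrier G) (indicator (dev G D))) \<longleftrightarrow>
         (\<exists>H. subgroup H (Atop X A) \<and> (Atop X A)\<lparr>carrier := H\<rparr> \<cong> G \<and>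
            sharply_transitive X H (\<lambda>(\<alpha>, \<beta>, \<gamma>). \<alpha>) \<and>
            sharply_transitive X H (\<lambda>(\<alpha>, \<beta>, \<gamma>). \<beta>) \<and>
            sharply_transitive X H (\<lambda>(\<alpha>, \<beta>, \<gamma>). \<gamma>))"
proof -
  interpret group G by fact
  \<comment> \<open>The carrier contains \<open>\<one>\<close>, and \<open>X\<close> has the same
    number \<open>v\<close> of elements, so base points in \<open>X\<close> exist.\<close>
  have "card (carrier G) \<noteq> 0"
    using assms(2) one_closed by (metis card_0_eq empty_iff)
  then have X: "X \<noteq> {}"
    using assms(3,4) by (auto simp: cubes_def order_def)
  show ?thesis
  proof (rule iffI; elim exE conjE)
    fix D
    assume "difference_set3 G v k l D" and "isotopic X A (carrier G) (indicator (dev G D))"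
    moreover from this have "D \<subseteq> carrier G \<times> carrier G"
      by (simp add: difference_set3_def)
    ultimately show "\<exists>H. subgroup H (Atop X A) \<and> (Atop X A)\<lparr>carrier := H\<rparr> \<cong> G \<and>
        sharply_transitive X H (\<lambda>(\<alpha>, \<beta>, \<gamma>). \<alpha>) \<and>
        sharply_transitive X H (\<lambda>(\<alpha>, \<beta>, \<gamma>). \<beta>) \<and>
        sharply_transitive X H (\<lambda>(\<alpha>, \<beta>, \<gamma>). \<gamma>)"
      using X by (intro sharply_transitive_subgroup_if_isotopic_dev)
  qed (rule difference_set3_if_sharply_transitive_subgroup[OF assms(4) X])
qed

end
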